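(* Let $\pi_n\in S_n$ be a uniformly random permutation and let $d_n(1),\dots,d_n(n)$ be the degree sequence of the associated permutation graph $G_{\pi_n}$. Then for indices $0<r_1<r_2<\cdots<r_s\le 1$, as $n\to\infty$, $$\left(\frac{d_n(\lceil nr_1\rceil)}{n},\frac{d_n(\lceil nr_2\rceil)}{n},\ldots,\frac{d_n(\lceil nr_s\rceil)}{n}\right)\to(D_1,D_2,\ldots,D_s)\quad\text{in distribution},$$ where $D_1,\dots,D_s$ are independent and $D_i$ has the uniform distribution $U(r_i,1-r_i)$ for every $i\in\{1,\dots,s\}$.
   Context: $S_n$ is the set of permutations of $[n]=\{1,\dots,n\}$. The permutation graph $G_{\pi_n}$ of $\pi_n\in S_n$ has vertex set $[n]$ and an edge between $i$ and $j$ iff $(i-j)(\pi_n(i)-\pi_n(j))<0$; $d_n(i)$ is the degree of vertex $i$. For $a,b\in[0,1]$, $U(a,b)$ denotes the uniform distribution on the interval $[\min\{a,b\},\max\{a,b\}]$ (the point mass at $a$ if $a=b$). *)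

theory Defs
  imports "HOL-Probability.Probability" "HOL-Combinatorics.Permutations"
begin

text \<open>Simple graphs on \<open>nat\<close> are given by their set of edges, an edge being a two-element set of
  vertices. The vertices of the permutation graph of \<open>p\<close> are \<open>{1..n}\<close>; the
  products are formed in \<open>int\<close>, since subtraction on \<open>nat\<close> truncates.\<close>

definition perm_graph_edges :: "nat \<Rightarrow> (nat \<Rightarrow> nat) \<Rightarrow> nat set set" where
  "perm_graph_edges n p =
     {{i, j} | i j. i \<in> {1..n} \<and> j \<in> {1..n} \<and>
                    (int i - int j) * (int (p i) - int (p j)) < 0}"

definition degree_in :: "nat set set \<Rightarrow> nat \<Rightarrow> nat" where
  "degree_in E v = card {e \<in> E. v \<in> e}"

definition perm_degree :: "nat \<Rightarrow> (nat \<Rightarrow> nat) \<Rightarrow> nat \<Rightarrow> nat" where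
  "perm_degree n p i = degree_in (perm_graph_edges n p) i"

definition uniform_perm :: "nat \<Rightarrow> (nat \<Rightarrow> nat) pmf" where
  "uniform_perm n = pmf_of_set {p. p permutes {1..n}}"

definition uniform_between :: "real \<Rightarrow> real \<Rightarrow> real measure" where
  "uniform_between a b =
     (if a = b then return borel a else uniform_measure lborel {min a b..max a b})"

text \<open>The library's \<open>weak_conv_m\<close> is confined to measures on the real line, so
  convergence in distribution of random vectors is defined by bounded continuous test functions.\<close>

definition converges_in_distribution ::
  "(nat \<Rightarrow> 'b measure) \<Rightarrow> (nat \<Rightarrow> 'b \<Rightarrow> 'a::metric_space) \<Rightarrow> 'c measure \<Rightarrow> ('c \<Rightarrow> 'a) \<Rightarrow> bool" where
  "converges_in_distribution N X M Y \<longleftrightarrow>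
     (\<forall>n. prob_space (N n) \<and> X n \<in> borel_measurable (N n)) \<and>
     prob_space M \<and> Y \<in> borel_measurable M \<and>
     (\<forall>f::'a \<Rightarrow> real. continuous_on UNIV f \<longrightarrow> bounded (range f) \<longrightarrow>
        (\<lambda>n. \<integral>x. f (X n x) \<partial>N n) \<longlonglongrightarrow> (\<integral>x. f (Y x) \<partial>M))"

end

theory Submission
  imports Defs
begin

text \<open>Fix a vertex \<open>i = \<lceil>n r\<rceil>\<close> and let \<open>A\<close> be the number of vertices \<open>j < i\<close> with \<open>p j < p i\<close>. Counting
  the vertices to the left of \<open>i\<close> and those with a smaller value gives the degree exactly as
  \<open>i + p i - 2 - 2 A\<close> (\<open>perm_degree_formula\<close>). Given \<open>p i\<close>, the variable \<open>A\<close> is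
  hypergeometric with mean \<open>(i - 1) (p i - 1) / (n - 1)\<close>, and its mean square deviation
  is at most \<open>n\<close> (\<open>smaller_left_second_moment\<close>), since indicators that arise from
  sampling without replacement have nonpositive correlations. Hence, with \<open>u = p i / n\<close>, the
  scaled degree differs from \<open>r + u - 2 r u = r + (1 - 2 r) u\<close> by \<open>O(1 / n)\<close> in mean square
  (\<open>degree_near_affine_second_moment\<close>): each scaled degree is asymptotically a function of
  the value at its own vertex.

  The values at \<open>s\<close> fixed positions form a uniformly random injective tuple
  (\<open>uniform_perm_at_positions\<close>). Almost all tuples are injective, so they may be replaced by
  \<open>s\<close> independent uniform values in \<open>{1..n}\<close>, which after division by \<open>n\<close> converge to
  independent uniform variables \<open>U\<^sub>1, \<dots>, U\<^sub>s\<close> on the unit interval; to see this, the discrete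
  values are realized as \<open>\<lceil>n U\<^sub>i\<rceil>\<close> (\<open>grid_average_tendsto_cube_integral\<close>). The affine map
  \<open>u \<mapsto> r + (1 - 2 r) u\<close> carries the unit interval onto the interval between \<open>r\<close> and \<open>1 - r\<close>
  and its uniform law to the law in the theorem; at \<open>r = 1 / 2\<close> it is constant, which gives
  the point mass.\<close>

section \<open>Degrees in a permutation graph\<close>

lemma perm_degree_eq_card_inversions:
  assumes "i \<in> {1..n}"
  shows "perm_degree n p i = card {j \<in> {1..n}. (int i - int j) * (int (p i) - int (p j)) < 0}"
proof -
  let ?N = "{j \<in> {1..n}. (int i - int j) * (int (p i) - int (p j)) < 0}"
  have sym: "(int x - int y) * (int (p x) - int (p y)) = (int y - int x) * (int (p y) - int (p x))"
    for x y by (simp add: algebra_simps)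
  have "{e \<in> perm_graph_edges n p. i \<in> e} = (\<lambda>j. {i, j}) ` ?N"
    using assms sym[of i] unfolding perm_graph_edges_def
    by (auto simp: insert_commute doubleton_eq_iff image_iff)
  moreover have "inj_on (\<lambda>j. {i, j}) ?N"
    by (auto intro!: inj_onI simp: doubleton_eq_iff)
  ultimately show ?thesis
    by (simp add: perm_degree_def degree_in_def card_image)
qed

text \<open>Among the \<open>i - 1\<close> vertices to the left of \<open>i\<close> and the \<open>p i - 1\<close> vertices with a smaller value,
  the vertices with both properties are exactly those that are not joined to \<open>i\<close>, and they are
  counted twice.\<close>

lemma perm_degree_formula:
  assumes p: "p permutes {1..n}" and i: "i \<in> {1..n}"
  shows "real (perm_degree n p i)
           = real i + real (p i) - 2 - 2 * real (card {j \<in> {1..<i}. p j < p i})"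
proof -
  define B where "B = {j \<in> {1..<i}. p j < p i}"
  define L where "L = {j \<in> {1..<i}. p i < p j}"
  define R where "R = {j \<in> {i<..n}. p j < p i}"
  have inj: "p j = p i \<longleftrightarrow> j = i" for j
    using permutes_inj[OF p] by (auto simp: inj_def)
  have pi: "p i \<in> {1..n}"
    using permutes_in_image[OF p] i by blast
  have "{j \<in> {1..n}. (int i - int j) * (int (p i) - int (p j)) < 0} = L \<union> R"
    using i by (auto simp: L_def R_def mult_less_0_iff)
  then have deg: "perm_degree n p i = card L + card R"
    unfolding perm_degree_eq_card_inversions[OF i]
    by (simp add: card_Un_disjoint L_def R_def disjoint_iff)
  have "{1..<i} = B \<union> L"
    using inj by (fastforce simp: B_def L_def)
  then have left: "i - 1 = card B + card L"
    by (metis (no_types, lifting) B_def L_def card_Un_disjoint card_atLeastLessThan disjoint_iff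
        finite_Collect_conjI finite_Un finite_atLeastLessThan mem_Collect_eq not_less_iff_gr_or_eq)
  have "{j \<in> {1..n}. p j < p i} = B \<union> R"
    using i by (auto simp: B_def R_def) (metis less_irrefl linorder_neqE_nat)
  then have "card {j \<in> {1..n}. p j < p i} = card B + card R"
    by (simp add: card_Un_disjoint B_def R_def disjoint_iff)
  moreover have "card {j \<in> {1..n}. p j < p i} = card {1..<p i}"
  proof (rule bij_betw_same_card)
    have "y \<in> p ` {j \<in> {1..n}. p j < p i}" if "y \<in> {1..<p i}" for y
    proof -
      have "y \<in> p ` {1..n}"
        using permutes_image[OF p] that pi by auto
      with that show ?thesis
        by auto
    qed
    moreover have "1 \<le> p j" if "j \<in> {1..n}" for j
      using permutes_in_image[OF p, of j] that by simp
    ultimately show "bij_betw p {j \<in> {1..n}. p j < p i} {1..<p i}"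
      by (intro bij_betwI' permutes_inj[OF p, THEN inj_eq]) (auto simp: image_iff)
  qed
  ultimately have "p i - 1 = card B + card R"
    by simp
  with deg left i pi show ?thesis
    unfolding B_def[symmetric] by auto
qed

section \<open>Uniform random permutations\<close>

lemma set_pmf_uniform_perm: "set_pmf (uniform_perm n) = {p. p permutes {1..n}}"
  unfolding uniform_perm_def
  by (rule set_pmf_of_set) (auto intro: permutes_id finite_permutations)

lemma finite_set_pmf_uniform_perm: "finite (set_pmf (uniform_perm n))"
  by (simp add: set_pmf_uniform_perm finite_permutations)

lemma integrable_uniform_perm [simp]:
  fixes f :: "(nat \<Rightarrow> nat) \<Rightarrow> real"
  shows "integrable (measure_pmf (uniform_perm n)) f"
  by (rule integrable_measure_pmf_finite[OF finite_set_pmf_uniform_perm])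

lemma map_pmf_uniform_perm_comp_right:
  assumes "\<tau> permutes {1..n}"
  shows "map_pmf (\<lambda>p. p \<circ> \<tau>) (uniform_perm n) = uniform_perm n"
  unfolding uniform_perm_def
proof (rule map_pmf_of_set_bij_betw)
  show "bij_betw (\<lambda>p. p \<circ> \<tau>) {p. p permutes {1..n}} {p. p permutes {1..n}}"
    by (rule bij_betwI[where g = "\<lambda>p. p \<circ> inv \<tau>"])
       (use assms in \<open>auto intro: permutes_compose permutes_inv
          simp: comp_assoc permutes_inv_o\<close>)
qed (auto intro: permutes_id finite_permutations)

lemma map_pmf_uniform_perm_comp_left:
  assumes "\<tau> permutes {1..n}"
  shows "map_pmf (\<lambda>p. \<tau> \<circ> p) (uniform_perm n) = uniform_perm n"
  unfolding uniform_perm_def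
proof (rule map_pmf_of_set_bij_betw)
  show "bij_betw (\<lambda>p. \<tau> \<circ> p) {p. p permutes {1..n}} {p. p permutes {1..n}}"
    by (rule bij_betwI[where g = "\<lambda>p. inv \<tau> \<circ> p"])
       (use assms in \<open>auto intro: permutes_compose permutes_inv
          simp: comp_assoc[symmetric] permutes_inv_o\<close>)
qed (auto intro: permutes_id finite_permutations)

lemma expectation_uniform_perm_comp_right:
  fixes g :: "(nat \<Rightarrow> nat) \<Rightarrow> real"
  assumes "\<tau> permutes {1..n}"
  shows "measure_pmf.expectation (uniform_perm n) (\<lambda>p. g (p \<circ> \<tau>))
           = measure_pmf.expectation (uniform_perm n) g"
proof -
  have "measure_pmf.expectation (uniform_perm n) g
          = measure_pmf.expectation (map_pmf (\<lambda>p. p \<circ> \<tau>) (uniform_perm n)) g"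
    by (simp only: map_pmf_uniform_perm_comp_right[OF assms])
  then show ?thesis
    by simp
qed

lemma inj_on_extends_to_permutation:
  assumes "finite S" and "A \<subseteq> S" and "f ` A \<subseteq> S" and inj: "inj_on f A"
  shows "\<exists>\<tau>. \<tau> permutes S \<and> (\<forall>x\<in>A. \<tau> x = f x)"
proof -
  have "card (S - A) = card (S - f ` A)"
    using assms by (simp add: card_Diff_subset card_image finite_subset[OF \<open>A \<subseteq> S\<close>])
  then obtain g where g: "bij_betw g (S - A) (S - f ` A)"
    using finite_same_card_bij[of "S - A" "S - f ` A"] \<open>finite S\<close> by auto
  define \<tau> where "\<tau> x = (if x \<in> A then f x else if x \<in> S then g x else x)" for x
  have "bij_betw \<tau> A (f ` A)"
    using inj by (simp add: bij_betw_def \<tau>_def inj_on_def)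
  moreover have "bij_betw \<tau> (S - A) (S - f ` A)"
    using g by (rule bij_betw_cong[THEN iffD1, rotated]) (simp add: \<tau>_def)
  ultimately have "bij_betw \<tau> (A \<union> (S - A)) (f ` A \<union> (S - f ` A))"
    by (rule bij_betw_combine) auto
  moreover have "A \<union> (S - A) = S" and "f ` A \<union> (S - f ` A) = S"
    using assms by auto
  ultimately have "\<tau> permutes S"
    using \<open>A \<subseteq> S\<close> by (intro bij_imp_permutes) (auto simp: \<tau>_def)
  then show ?thesis
    by (auto simp: \<tau>_def)
qed

section \<open>Concentration of the number of smaller entries to the left\<close>

text \<open>The variance bound behind sampling without replacement. Since the whole family sums to \<open>0\<close>, so
  does the matrix of second moments; the diagonal contributes \<open>card T * v\<close>, so the common
  off-diagonal entry \<open>c\<close> cannot be positive, and the partial sums have at most the second moment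
  that they would have if the variables were uncorrelated.\<close>

lemma exchangeable_partial_sum_second_moment:
  fixes X :: "'i \<Rightarrow> 'a \<Rightarrow> real" and M :: "'a pmf"
  assumes fin: "finite T" and ST: "S \<subseteq> T" and M: "finite (set_pmf M)"
    and diag: "\<And>j. j \<in> T \<Longrightarrow> measure_pmf.expectation M (\<lambda>x. X j x * X j x) = v"
    and off: "\<And>j l. j \<in> T \<Longrightarrow> l \<in> T \<Longrightarrow> j \<noteq> l \<Longrightarrow> measure_pmf.expectation M (\<lambda>x. X j x * X l x) = c"
    and zero: "\<And>x. x \<in> set_pmf M \<Longrightarrow> (\<Sum>j\<in>T. X j x) = 0"
  shows "measure_pmf.expectation M (\<lambda>x. (\<Sum>j\<in>S. X j x)\<^sup>2) \<le> real (card S) * v"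
proof -
  have int [simp]: "integrable (measure_pmf M) f" for f :: "'a \<Rightarrow> real"
    by (rule integrable_measure_pmf_finite[OF M])
  have moment: "measure_pmf.expectation M (\<lambda>x. (\<Sum>j\<in>R. X j x)\<^sup>2)
                  = real (card R) * v + real (card R) * (real (card R) - 1) * c"
    if R: "R \<subseteq> T" for R
  proof -
    have finR: "finite R"
      using R fin by (rule finite_subset)
    have "measure_pmf.expectation M (\<lambda>x. (\<Sum>j\<in>R. X j x)\<^sup>2)
            = (\<Sum>j\<in>R. \<Sum>l\<in>R. measure_pmf.expectation M (\<lambda>x. X j x * X l x))"
      by (simp add: power2_eq_square sum_product)
    also have "\<dots> = (\<Sum>j\<in>R. \<Sum>l\<in>R. (if j = l then v - c else 0) + c)"
      using R diag off by (intro sum.cong refl) (auto simp: subset_iff)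
    also have "\<dots> = (\<Sum>j\<in>R. (v - c) + real (card R) * c)"
      using finR by (simp add: sum.distrib)
    finally show ?thesis
      by (simp add: algebra_simps)
  qed
  \<comment> \<open>If \<open>T\<close> has at most one element there are no pairs and \<open>c\<close> is arbitrary, but then the coefficient
    of \<open>c\<close> vanishes.\<close>
  have nonpos: "real (card S) * (real (card S) - 1) * c \<le> 0"
  proof (cases "card T \<le> 1")
    case True
    then have "card S = 0 \<or> card S = 1"
      using card_mono[OF fin ST] by linarith
    then show ?thesis
      by auto
  next
    case False
    have "measure_pmf.expectation M (\<lambda>x. (\<Sum>j\<in>T. X j x)\<^sup>2) = measure_pmf.expectation M (\<lambda>x. 0)"
      using zero by (intro integral_cong_AE) (auto simp: AE_measure_pmf_iff)
    then have "real (card T) * (v + (real (card T) - 1) * c) = 0"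
      using moment[of T] by (simp add: algebra_simps)
    then have eq: "v + (real (card T) - 1) * c = 0"
      using False by auto
    obtain j where "j \<in> T"
      using False by fastforce
    moreover have "0 \<le> measure_pmf.expectation M (\<lambda>x. X j x * X j x)"
      by (intro Bochner_Integration.integral_nonneg) auto
    ultimately have "v \<ge> 0"
      by (simp add: diag)
    with eq have "(real (card T) - 1) * c \<le> 0"
      by linarith
    then have "c \<le> 0"
      using False by (simp add: mult_le_0_iff)
    moreover have "real (card S) * (real (card S) - 1) \<ge> 0"
      by (cases "card S") auto
    ultimately show ?thesis
      by (rule mult_nonneg_nonpos[rotated])
  qed
  then show ?thesis
    using moment[OF ST] by linarith
qed

text \<open>Given the value at \<open>i\<close>, the positions of the \<open>p i - 1\<close> smaller values form a uniformly random
  subset of the other positions, so the number of them to the left of \<open>i\<close> is hypergeometric. Of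
  this only the exchangeability is used: a permutation of the positions that fixes \<open>i\<close> carries any
  pair of other positions to any other pair.\<close>

lemma smaller_left_second_moment:
  assumes n: "2 \<le> n" and i: "i \<in> {1..n}"
  shows "measure_pmf.expectation (uniform_perm n)
           (\<lambda>p. (real (card {j \<in> {1..<i}. p j < p i})
                  - (real i - 1) * (real (p i) - 1) / (real n - 1))\<^sup>2) \<le> real n"
proof -
  let ?E = "measure_pmf.expectation (uniform_perm n)"
  define X where "X j p = of_bool (p j < p i) - (real (p i) - 1) / (real n - 1)"
    for j and p :: "nat \<Rightarrow> nat"
  define T where "T = {1..n} - {i}"
  define S where "S = {1..<i}"
  have ST: "S \<subseteq> T" and finT: "finite T"
    using i by (auto simp: S_def T_def)
  have shift: "?E (\<lambda>p. X (\<tau> j) p * X (\<tau> l) p) = ?E (\<lambda>p. X j p * X l p)"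
    if "\<tau> permutes {1..n}" "\<tau> i = i" for \<tau> j l
    using expectation_uniform_perm_comp_right[OF that(1), of "\<lambda>p. X j p * X l p"] that(2)
    by (simp add: X_def)
  have sum_zero: "(\<Sum>j\<in>T. X j p) = 0" if "p \<in> set_pmf (uniform_perm n)" for p
  proof -
    from that have p: "p permutes {1..n}"
      by (simp add: set_pmf_uniform_perm)
    have pi: "p i \<in> {1..n}"
      using permutes_in_image[OF p] i by blast
    have "(\<Sum>j\<in>T. of_bool (p j < p i)) = (\<Sum>j\<in>{1..n}. of_bool (p j < p i) :: real)"
      unfolding T_def using i by (subst sum.remove[of "{1..n}" i]) auto
    also have "\<dots> = (\<Sum>k\<in>{1..n}. of_bool (k < p i))"
      using sum.permute[OF p, of "\<lambda>k. of_bool (k < p i) :: real"] by (simp add: o_def)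
    also have "\<dots> = real (card ({1..n} \<inter> {k. k < p i}))"
      by (simp add: of_bool_def sum.If_cases)
    also have "{1..n} \<inter> {k. k < p i} = {1..<p i}"
      using pi by auto
    finally have "(\<Sum>j\<in>T. of_bool (p j < p i)) = real (p i) - 1"
      using pi by simp
    moreover have "real (card T) = real n - 1"
      using i n by (simp add: T_def)
    ultimately show ?thesis
      using n by (simp add: X_def sum_subtractf)
  qed
  obtain j0 where j0: "j0 \<in> T"
    using n i by (auto simp: T_def intro: that[of "if i = 1 then 2 else 1"])
  define v where "v = ?E (\<lambda>p. X j0 p * X j0 p)"
  have diag: "?E (\<lambda>p. X j p * X j p) = v" if "j \<in> T" for j
  proof -
    have "\<exists>\<tau>. \<tau> permutes {1..n} \<and> (\<forall>x\<in>{i, j0}. \<tau> x = (if x = i then i else j))"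
      using i j0 that by (intro inj_on_extends_to_permutation) (auto simp: T_def inj_on_def)
    then obtain \<tau> where "\<tau> permutes {1..n}" "\<tau> i = i" "\<tau> j0 = j"
      using j0 by (auto simp: T_def)
    with shift[of \<tau> j0 j0] show ?thesis
      by (simp add: v_def)
  qed
  have "\<exists>c. \<forall>j\<in>T. \<forall>l\<in>T. j \<noteq> l \<longrightarrow> ?E (\<lambda>p. X j p * X l p) = c"
  proof (cases "\<exists>l0\<in>T. l0 \<noteq> j0")
    case True
    then obtain l0 where l0: "l0 \<in> T" "l0 \<noteq> j0"
      by blast
    have "?E (\<lambda>p. X j p * X l p) = ?E (\<lambda>p. X j0 p * X l0 p)"
      if "j \<in> T" "l \<in> T" "j \<noteq> l" for j l
    proof -
      have "\<exists>\<tau>. \<tau> permutes {1..n} \<and>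
              (\<forall>x\<in>{i, j0, l0}. \<tau> x = (if x = i then i else if x = j0 then j else l))"
        using i j0 l0 that by (intro inj_on_extends_to_permutation) (auto simp: T_def inj_on_def)
      then obtain \<tau> where "\<tau> permutes {1..n}" "\<tau> i = i" "\<tau> j0 = j" "\<tau> l0 = l"
        using j0 l0 by (auto simp: T_def)
      with shift[of \<tau> j0 l0] show ?thesis
        by simp
    qed
    then show ?thesis
      by blast
  next
    \<comment> \<open>For \<open>n = 2\<close> there is no pair of distinct positions other than \<open>i\<close>.\<close>
    case False
    then show ?thesis
      using j0 by metis
  qed
  then obtain c where c: "\<forall>j\<in>T. \<forall>l\<in>T. j \<noteq> l \<longrightarrow> ?E (\<lambda>p. X j p * X l p) = c" ..
  have off: "?E (\<lambda>p. X j p * X l p) = c" if "j \<in> T" "l \<in> T" "j \<noteq> l" for j l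
    using c that by simp
  have "?E (\<lambda>p. (\<Sum>j\<in>S. X j p)\<^sup>2) \<le> real (card S) * v"
    by (rule exchangeable_partial_sum_second_moment[OF finT ST finite_set_pmf_uniform_perm diag off
          sum_zero])
  also have "\<dots> \<le> real n * 1"
  proof (rule mult_mono)
    have "?E (\<lambda>p. X j0 p * X j0 p) \<le> ?E (\<lambda>p. 1)"
    proof (rule integral_mono_AE)
      have "X j0 p * X j0 p \<le> 1" if p: "p permutes {1..n}" for p
      proof -
        have "p i \<in> {1..n}"
          using permutes_in_image[OF p] i by blast
        then have "0 \<le> (real (p i) - 1) / (real n - 1)" "(real (p i) - 1) / (real n - 1) \<le> 1"
          using n by auto
        moreover have "\<bar>of_bool b - t\<bar> \<le> 1" if "0 \<le> t" "t \<le> 1" for b and t :: real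
          using that by (cases b) auto
        ultimately have "\<bar>X j0 p\<bar> \<le> 1"
          unfolding X_def by blast
        then show ?thesis
          using abs_square_le_1[of "X j0 p"] by (simp add: power2_eq_square)
      qed
      then show "AE p in uniform_perm n. X j0 p * X j0 p \<le> 1"
        by (auto simp: AE_measure_pmf_iff set_pmf_uniform_perm)
    qed auto
    then show "v \<le> 1"
      by (simp add: v_def)
    show "0 \<le> v"
      unfolding v_def by (intro Bochner_Integration.integral_nonneg) auto
  qed (use i in \<open>auto simp: S_def\<close>)
  finally have "?E (\<lambda>p. (\<Sum>j\<in>S. X j p)\<^sup>2) \<le> real n"
    by simp
  moreover have "(\<Sum>j\<in>S. X j p) = real (card {j \<in> {1..<i}. p j < p i})
                  - (real i - 1) * (real (p i) - 1) / (real n - 1)" for p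
  proof -
    have "(\<Sum>j\<in>S. of_bool (p j < p i) :: real) = real (card {j \<in> {1..<i}. p j < p i})"
      by (simp add: S_def of_bool_def sum.If_cases Int_def)
    moreover have "real (card S) = real i - 1"
      using i by (simp add: S_def)
    ultimately show ?thesis
      by (simp add: X_def sum_subtractf)
  qed
  ultimately show ?thesis
    by simp
qed

section \<open>The values at finitely many positions\<close>

lemma pmf_of_set_eqI:
  assumes fin: "finite S" and sub: "set_pmf Q \<subseteq> S"
    and const: "\<And>x y. x \<in> S \<Longrightarrow> y \<in> S \<Longrightarrow> pmf Q x = pmf Q y"
  shows "Q = pmf_of_set S"
proof -
  have ne: "S \<noteq> {}"
    using sub set_pmf_not_empty[of Q] by blast
  then obtain x0 where x0: "x0 \<in> S"
    by blast
  have "1 = (\<Sum>x\<in>S. pmf Q x)"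
    using sum_pmf_eq_1[OF fin sub] by simp
  also have "\<dots> = (\<Sum>x\<in>S. pmf Q x0)"
    using const x0 by (intro sum.cong refl) blast
  also have "\<dots> = real (card S) * pmf Q x0"
    by simp
  finally have x0': "pmf Q x0 = 1 / real (card S)"
    using fin ne by (auto simp: field_simps card_eq_0_iff)
  show ?thesis
  proof (rule pmf_eqI)
    fix x
    show "pmf Q x = pmf (pmf_of_set S) x"
    proof (cases "x \<in> S")
      case True
      then show ?thesis
        using const[OF True x0] x0' fin ne by simp
    next
      case False
      then have "x \<notin> set_pmf Q"
        using sub by blast
      then show ?thesis
        using False fin ne by (simp add: set_pmf_eq)
    qed
  qed
qed

definition injective_tuples :: "nat \<Rightarrow> ('s \<Rightarrow> nat) set" where
  "injective_tuples n = {k \<in> UNIV \<rightarrow>\<^sub>E {1..n}. inj k}"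

lemma finite_injective_tuples: "finite (injective_tuples n :: ('s::finite \<Rightarrow> nat) set)"
  unfolding injective_tuples_def by (rule finite_subset[OF _ finite_PiE[of UNIV "\<lambda>_. {1..n}"]]) auto

text \<open>Composing \<open>p\<close> on the left with a permutation of the values preserves its law and can carry any
  injective tuple of values to any other.\<close>

lemma uniform_perm_at_positions:
  fixes a :: "'s::finite \<Rightarrow> nat"
  assumes a: "inj a" "range a \<subseteq> {1..n}"
  shows "map_pmf (\<lambda>p. p \<circ> a) (uniform_perm n) = pmf_of_set (injective_tuples n)"
proof (rule pmf_of_set_eqI[OF finite_injective_tuples])
  let ?Q = "map_pmf (\<lambda>p. p \<circ> a) (uniform_perm n)"
  have "p \<circ> a \<in> injective_tuples n" if p: "p permutes {1..n}" for p
    using a permutes_in_image[OF p] permutes_inj[OF p]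
    by (auto simp: injective_tuples_def image_subset_iff PiE_UNIV_domain inj_compose)
  then show "set_pmf ?Q \<subseteq> injective_tuples n"
    by (auto simp: set_pmf_uniform_perm)
  fix k l :: "'s \<Rightarrow> nat"
  assume k: "k \<in> injective_tuples n" and l: "l \<in> injective_tuples n"
  have "\<exists>\<tau>. \<tau> permutes {1..n} \<and> (\<forall>x\<in>range k. \<tau> x = l (inv k x))"
  proof (rule inj_on_extends_to_permutation)
    show "inj_on (\<lambda>x. l (inv k x)) (range k)"
      using k l by (auto simp: injective_tuples_def inj_on_def)
  qed (use k l in \<open>auto simp: injective_tuples_def PiE_UNIV_domain Pi_iff\<close>)
  then obtain \<tau> where \<tau>: "\<tau> permutes {1..n}" and "\<forall>x\<in>range k. \<tau> x = l (inv k x)"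
    by blast
  then have \<tau>k: "\<tau> \<circ> k = l"
    using k by (auto simp: injective_tuples_def fun_eq_iff)
  have "map_pmf (\<lambda>m. \<tau> \<circ> m) ?Q = map_pmf (\<lambda>p. p \<circ> a) (map_pmf (\<lambda>p. \<tau> \<circ> p) (uniform_perm n))"
    by (simp add: map_pmf_comp comp_assoc)
  also have "\<dots> = ?Q"
    by (simp only: map_pmf_uniform_perm_comp_left[OF \<tau>])
  finally have Q: "map_pmf (\<lambda>m. \<tau> \<circ> m) ?Q = ?Q" .
  have "inj (\<lambda>m :: 's \<Rightarrow> nat. \<tau> \<circ> m)"
    using permutes_inj[OF \<tau>] by (auto simp: inj_def fun_eq_iff)
  then have "pmf (map_pmf (\<lambda>m. \<tau> \<circ> m) ?Q) (\<tau> \<circ> k) = pmf ?Q k"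
    by (rule pmf_map_inj')
  then show "pmf ?Q k = pmf ?Q l"
    by (simp only: Q \<tau>k)
qed

text \<open>Passing from \<open>A\<close> to \<open>I\<close> changes the average in two ways, each by at most \<open>B\<close> times the fraction of
  \<open>A\<close> outside \<open>I\<close>: the terms outside \<open>I\<close> are dropped, and the weights of the others grow.\<close>

lemma average_subset_approx:
  fixes h :: "'a \<Rightarrow> real"
  assumes fin: "finite A" and IA: "I \<subseteq> A" and ne: "I \<noteq> {}" and h: "\<And>x. \<bar>h x\<bar> \<le> B"
  shows "\<bar>sum h I / real (card I) - sum h A / real (card A)\<bar>
           \<le> 2 * B * (1 - real (card I) / real (card A))"
proof -
  define N where "N = real (card A)"
  define m where "m = real (card I)"
  have finI: "finite I"
    using IA fin by (rule finite_subset)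
  have m: "0 < m" "m \<le> N"
    using ne finI card_mono[OF fin IA] by (auto simp: m_def N_def card_gt_0_iff)
  have rest: "\<bar>sum h (A - I)\<bar> \<le> (N - m) * B"
  proof -
    have "\<bar>sum h (A - I)\<bar> \<le> (\<Sum>x\<in>A - I. B)"
      using h by (intro order.trans[OF sum_abs] sum_mono)
    also have "\<dots> = (N - m) * B"
      using IA finI card_mono[OF fin IA] by (simp add: card_Diff_subset N_def m_def of_nat_diff)
    finally show ?thesis .
  qed
  have main: "\<bar>sum h I\<bar> \<le> m * B"
  proof -
    have "\<bar>sum h I\<bar> \<le> (\<Sum>x\<in>I. B)"
      using h by (intro order.trans[OF sum_abs] sum_mono)
    then show ?thesis
      by (simp add: m_def)
  qed
  have "sum h A = sum h (A - I) + sum h I"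
    by (rule sum.subset_diff[OF IA fin])
  then have "sum h I / m - sum h A / N = ((N - m) * (sum h I / m) - sum h (A - I)) / N"
    using m by (simp add: field_simps)
  also have "\<bar>\<dots>\<bar> \<le> ((N - m) * B + (N - m) * B) / N"
  proof -
    have "\<bar>sum h I / m\<bar> \<le> B"
      using main m by (simp add: field_simps)
    then have "\<bar>(N - m) * (sum h I / m)\<bar> \<le> (N - m) * B"
      using m by (simp only: abs_mult) (intro mult_mono, auto)
    then have "\<bar>(N - m) * (sum h I / m) - sum h (A - I)\<bar> \<le> (N - m) * B + (N - m) * B"
      using rest by (intro order.trans[OF abs_triangle_ineq4] add_mono)
    with m show ?thesis
      by (simp add: divide_right_mono)
  qed
  also have "\<dots> = 2 * B * (1 - m / N)"
    using m by (simp add: field_simps)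
  finally show ?thesis
    by (simp add: m_def N_def)
qed

lemma injective_tuples_ratio_tendsto_1:
  "(\<lambda>n. real (card (injective_tuples n :: ('s::finite \<Rightarrow> nat) set))
          / real (card ((UNIV :: 's set) \<rightarrow>\<^sub>E {1..n}))) \<longlonglongrightarrow> 1"
proof -
  have "(\<lambda>n. \<Prod>j\<in>{0..<CARD('s)}. (real n - real j) / real n) \<longlonglongrightarrow> (\<Prod>j\<in>{0..<CARD('s)}. 1)"
  proof (intro tendsto_prod)
    fix j
    have "(\<lambda>n. 1 - real j / real n) \<longlonglongrightarrow> 1 - 0"
      by (intro tendsto_intros lim_const_over_n)
    moreover have "\<forall>\<^sub>F n in sequentially. 1 - real j / real n = (real n - real j) / real n"
      using eventually_gt_at_top[of 0] by eventually_elim (simp add: diff_divide_distrib)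
    ultimately show "(\<lambda>n. (real n - real j) / real n) \<longlonglongrightarrow> 1"
      by (simp add: Lim_transform_eventually)
  qed
  moreover have "\<forall>\<^sub>F n in sequentially. (\<Prod>j\<in>{0..<CARD('s)}. (real n - real j) / real n)
      = real (card (injective_tuples n :: ('s \<Rightarrow> nat) set)) / real (card ((UNIV :: 's set) \<rightarrow>\<^sub>E {1..n}))"
    using eventually_ge_at_top[of "CARD('s)"]
  proof eventually_elim
    case (elim n)
    have "card (injective_tuples n :: ('s \<Rightarrow> nat) set) = (\<Prod>j\<in>{0..<CARD('s)}. n - j)"
      using card_inj_on_subset_funcset[of "UNIV :: 's set" "{1..n}" UNIV]
      by (simp add: injective_tuples_def)
    also have "real \<dots> = (\<Prod>j\<in>{0..<CARD('s)}. real n - real j)"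
      using elim by (subst of_nat_prod) (auto intro!: prod.cong simp: of_nat_diff)
    finally show ?case
      by (simp add: card_funcsetE prod_dividef)
  qed
  ultimately show ?thesis
    by (simp add: Lim_transform_eventually)
qed

text \<open>Sampling \<open>s\<close> values without replacement is asymptotically the same as sampling them with
  replacement, since repetitions are rare.\<close>

lemma expectation_at_positions_tendsto:
  fixes h :: "nat \<Rightarrow> ('s::finite \<Rightarrow> nat) \<Rightarrow> real" and a :: "nat \<Rightarrow> 's \<Rightarrow> nat"
  assumes a: "\<forall>\<^sub>F n in sequentially. inj (a n) \<and> range (a n) \<subseteq> {1..n}"
    and h: "\<And>n k. \<bar>h n k\<bar> \<le> B"
    and lim: "(\<lambda>n. sum (h n) (UNIV \<rightarrow>\<^sub>E {1..n}) / real (card ((UNIV :: 's set) \<rightarrow>\<^sub>E {1..n}))) \<longlonglongrightarrow> L"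
  shows "(\<lambda>n. measure_pmf.expectation (uniform_perm n) (\<lambda>p. h n (p \<circ> a n))) \<longlonglongrightarrow> L"
proof -
  let ?A = "\<lambda>n. (UNIV :: 's set) \<rightarrow>\<^sub>E {1..n}"
  let ?I = "\<lambda>n. injective_tuples n :: ('s \<Rightarrow> nat) set"
  let ?e = "\<lambda>n. measure_pmf.expectation (uniform_perm n) (\<lambda>p. h n (p \<circ> a n))"
  have bound: "\<forall>\<^sub>F n in sequentially. norm (?e n - sum (h n) (?A n) / real (card (?A n)))
          \<le> 2 * B * (1 - real (card (?I n)) / real (card (?A n)))"
    using a
  proof eventually_elim
    case (elim n)
    have ne: "?I n \<noteq> {}"
      using elim by (auto simp: injective_tuples_def PiE_UNIV_domain image_subset_iff intro: exI[of _ "a n"])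
    have "?e n = measure_pmf.expectation (map_pmf (\<lambda>p. p \<circ> a n) (uniform_perm n)) (h n)"
      by simp
    also have "\<dots> = sum (h n) (?I n) / real (card (?I n))"
      using elim by (simp only: uniform_perm_at_positions)
        (rule integral_pmf_of_set[OF ne finite_injective_tuples])
    finally have "?e n = sum (h n) (?I n) / real (card (?I n))" .
    moreover have "?I n \<subseteq> ?A n"
      by (auto simp: injective_tuples_def)
    ultimately show ?case
      using average_subset_approx[of "?A n" "?I n" "h n" B] ne h by (simp add: finite_PiE)
  qed
  have "(\<lambda>n. 2 * B * (1 - real (card (?I n)) / real (card (?A n)))) \<longlonglongrightarrow> 2 * B * (1 - 1)"
    by (intro tendsto_intros injective_tuples_ratio_tendsto_1)
  then have "(\<lambda>n. 2 * B * (1 - real (card (?I n)) / real (card (?A n)))) \<longlonglongrightarrow> 0"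
    by simp
  then have "(\<lambda>n. ?e n - sum (h n) (?A n) / real (card (?A n))) \<longlonglongrightarrow> 0"
    by (rule Lim_null_comparison[OF bound])
  from tendsto_add[OF this lim] show ?thesis
    by simp
qed

section \<open>Independent uniform variables and their discretization\<close>

definition unit_uniform :: "real measure" where
  "unit_uniform = uniform_measure lborel {0..1}"

definition cube_uniform :: "('s::finite \<Rightarrow> real) measure" where
  "cube_uniform = (\<Pi>\<^sub>M i\<in>UNIV. unit_uniform)"

lemma sets_unit_uniform [measurable_cong, simp]: "sets unit_uniform = sets borel"
  by (simp add: unit_uniform_def)

lemma space_unit_uniform [simp]: "space unit_uniform = UNIV"
  by (simp add: unit_uniform_def)

lemma prob_space_unit_uniform: "prob_space unit_uniform"
  unfolding unit_uniform_def by (rule prob_space_uniform_measure) auto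

lemma emeasure_unit_uniform:
  "A \<in> sets borel \<Longrightarrow> emeasure unit_uniform A = emeasure lborel ({0..1} \<inter> A)"
  by (simp add: unit_uniform_def divide_ennreal_def)

lemma sets_cube_uniform [measurable_cong, simp]:
  "sets (cube_uniform :: ('s::finite \<Rightarrow> real) measure) = sets (\<Pi>\<^sub>M i\<in>UNIV. borel)"
  unfolding cube_uniform_def by (intro sets_PiM_cong) auto

lemma space_cube_uniform [simp]: "space (cube_uniform :: ('s::finite \<Rightarrow> real) measure) = UNIV"
  by (simp add: cube_uniform_def space_PiM)

lemma prob_space_cube_uniform: "prob_space (cube_uniform :: ('s::finite \<Rightarrow> real) measure)"
  unfolding cube_uniform_def by (intro prob_space_PiM prob_space_unit_uniform)

lemma emeasure_cube_uniform_box: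
  assumes "\<And>i. A i \<in> sets borel"
  shows "emeasure (cube_uniform :: ('s::finite \<Rightarrow> real) measure) (Pi\<^sub>E UNIV A)
           = (\<Prod>i\<in>UNIV. emeasure unit_uniform (A i))"
proof -
  interpret product_prob_space "\<lambda>_ :: 's. unit_uniform" UNIV
    by (intro product_prob_spaceI prob_space_unit_uniform)
  show ?thesis
    unfolding cube_uniform_def using assms by (intro emeasure_PiM) auto
qed

lemma AE_cube_uniform: "AE \<omega> in (cube_uniform :: ('s::finite \<Rightarrow> real) measure). \<forall>i. \<omega> i \<in> {0<..1}"
proof -
  have "AE x in lborel. x \<noteq> (0 :: real)"
    by (rule AE_lborel_singleton)
  then have "AE x in unit_uniform. x \<in> {0<..1}"
    unfolding unit_uniform_def by (intro AE_uniform_measureI) (auto elim: eventually_mono)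
  then have "AE \<omega> in (cube_uniform :: ('s \<Rightarrow> real) measure). \<omega> i \<in> {0<..1}" for i
    unfolding cube_uniform_def
    by (intro AE_PiM_component[where P = "\<lambda>x. x \<in> {0<..1}"] prob_space_unit_uniform) auto
  then show ?thesis
    by (subst AE_all_countable) blast
qed

lemma borel_measurable_vec_lambda:
  fixes f :: "'s::finite \<Rightarrow> 'a \<Rightarrow> real"
  assumes "\<And>i. f i \<in> borel_measurable M"
  shows "(\<lambda>x. \<chi> i. f i x) \<in> borel_measurable M"
  using assms by (subst borel_measurable_euclidean_space) (auto simp: Basis_vec_def inner_axis)

lemma ceiling_in_grid:
  assumes "0 < n" and "x \<in> {0<..1 :: real}"
  shows "nat \<lceil>real n * x\<rceil> \<in> {1..n}"
proof -
  have "0 < real n * x" and "real n * x \<le> real n"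
    using assms by (auto simp: mult_le_cancel_left1)
  then show ?thesis
    by (simp add: Suc_le_eq nat_le_iff ceiling_le_iff)
qed

lemma tendsto_ceiling_over_n:
  "(\<lambda>n. real (nat \<lceil>real n * x\<rceil>) / real n) \<longlonglongrightarrow> x" if "0 \<le> x"
proof (rule tendsto_sandwich)
  show "\<forall>\<^sub>F n in sequentially. x \<le> real (nat \<lceil>real n * x\<rceil>) / real n"
    using eventually_gt_at_top[of 0] by eventually_elim (simp add: field_simps of_nat_ceiling)
  show "\<forall>\<^sub>F n in sequentially. real (nat \<lceil>real n * x\<rceil>) / real n \<le> x + 1 / real n"
    using eventually_gt_at_top[of 0]
  proof eventually_elim
    case (elim n)
    have "real (nat \<lceil>real n * x\<rceil>) = of_int \<lceil>real n * x\<rceil>"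
      using that by simp
    also have "\<dots> \<le> real n * x + 1"
      by linarith
    finally show ?case
      using elim by (simp add: field_simps)
  qed
  have "(\<lambda>n. x + 1 / real n) \<longlonglongrightarrow> x + 0"
    by (intro tendsto_intros lim_const_over_n)
  then show "(\<lambda>n. x + 1 / real n) \<longlonglongrightarrow> x"
    by simp
qed simp

text \<open>The vector \<open>\<lceil>n U\<rceil>\<close> takes every value in the grid with the same probability, because each
  grid point \<open>k\<close> is attained on a product of intervals of length \<open>1 / n\<close>.\<close>

lemma integral_discretized_cube_uniform:
  fixes h :: "('s::finite \<Rightarrow> nat) \<Rightarrow> real"
  assumes n: "0 < n"
  shows "(\<integral>\<omega>. h (\<lambda>i. nat \<lceil>real n * \<omega> i\<rceil>) \<partial>cube_uniform)
           = sum h (UNIV \<rightarrow>\<^sub>E {1..n}) / real (card ((UNIV :: 's set) \<rightarrow>\<^sub>E {1..n}))"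
proof -
  interpret P: prob_space "cube_uniform :: ('s \<Rightarrow> real) measure"
    by (rule prob_space_cube_uniform)
  let ?A = "(UNIV :: 's set) \<rightarrow>\<^sub>E {1..n}"
  let ?K = "\<lambda>(\<omega> :: 's \<Rightarrow> real) i. nat \<lceil>real n * \<omega> i\<rceil>"
  define C where "C k = Pi\<^sub>E (UNIV :: 's set) (\<lambda>i. {(real (k i) - 1) / real n <.. real (k i) / real n})" for k
  have fin: "finite ?A"
    by (intro finite_PiE) auto
  have C_iff: "\<omega> \<in> C k \<longleftrightarrow> ?K \<omega> = k" if "k \<in> ?A" "\<forall>i. \<omega> i \<in> {0<..1}" for k \<omega>
  proof -
    have "(real m - 1) / real n < x \<and> x \<le> real m / real n \<longleftrightarrow> nat \<lceil>real n * x\<rceil> = m"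
      if "1 \<le> m" "0 < x" for m x
    proof -
      have "nat \<lceil>real n * x\<rceil> = m \<longleftrightarrow> \<lceil>real n * x\<rceil> = int m"
        using that by auto
      also have "\<dots> \<longleftrightarrow> real m - 1 < real n * x \<and> real n * x \<le> real m"
        by (auto simp: ceiling_eq_iff)
      finally show ?thesis
        using n by (simp add: field_simps)
    qed
    moreover have "1 \<le> k i" for i
      using that(1) by (auto simp: PiE_UNIV_domain)
    ultimately show ?thesis
      using that(2) by (auto simp: C_def PiE_UNIV_domain fun_eq_iff)
  qed
  have C_sets: "C k \<in> sets (cube_uniform :: ('s \<Rightarrow> real) measure)" for k
    unfolding C_def sets_cube_uniform by (intro sets_PiM_I_finite) auto
  have C_prob: "measure cube_uniform (C k) = 1 / real (card ?A)" if k: "k \<in> ?A" for k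
  proof -
    have "emeasure unit_uniform {(real m - 1) / real n <.. real m / real n} = ennreal (1 / real n)"
      if m: "1 \<le> m" "m \<le> n" for m
    proof -
      have "0 \<le> (real m - 1) / real n" "real m / real n \<le> 1"
        using m n by auto
      then have "{0..1} \<inter> {(real m - 1) / real n <.. real m / real n}
                   = {(real m - 1) / real n <.. real m / real n}"
        by auto
      then show ?thesis
        using n by (simp add: emeasure_unit_uniform divide_right_mono diff_divide_distrib)
    qed
    moreover have "1 \<le> k i" "k i \<le> n" for i
      using k by (auto simp: PiE_UNIV_domain Pi_iff)
    ultimately have "emeasure cube_uniform (C k) = (\<Prod>i\<in>(UNIV :: 's set). ennreal (1 / real n))"
      unfolding C_def by (subst emeasure_cube_uniform_box) auto
    also have "\<dots> = ennreal ((1 / real n) ^ CARD('s))"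
      by (simp add: ennreal_power)
    also have "(1 / real n) ^ CARD('s) = 1 / real (card ?A)"
      by (simp add: card_funcsetE power_one_over)
    finally show ?thesis
      by (simp add: measure_def)
  qed
  have decomp: "AE \<omega> in cube_uniform. h (?K \<omega>) = (\<Sum>k\<in>?A. h k * indicator (C k) \<omega>)"
    using AE_cube_uniform
  proof eventually_elim
    case (elim \<omega>)
    have K: "?K \<omega> \<in> ?A"
      using elim ceiling_in_grid[OF n] by (auto simp: PiE_UNIV_domain Pi_iff)
    have "(\<Sum>k\<in>?A. h k * indicator (C k) \<omega>) = (\<Sum>k\<in>?A. if k = ?K \<omega> then h k else 0)"
      using elim by (intro sum.cong refl) (auto simp: C_iff indicator_def)
    with K fin show ?case
      by simp
  qed
  have meas: "(\<lambda>\<omega>. h (?K \<omega>)) \<in> borel_measurable (cube_uniform :: ('s \<Rightarrow> real) measure)"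
  proof -
    have "?K \<in> measurable (cube_uniform :: ('s \<Rightarrow> real) measure) (\<Pi>\<^sub>M i\<in>(UNIV :: 's set). count_space UNIV)"
      by (rule measurable_PiM_single') (auto simp: space_PiM)
    also have "(\<Pi>\<^sub>M i\<in>(UNIV :: 's set). count_space UNIV) = count_space (UNIV :: ('s \<Rightarrow> nat) set)"
      by (subst count_space_PiM_finite) (auto simp: PiE_UNIV_domain)
    finally show ?thesis
      by (rule measurable_compose) simp
  qed
  have int: "integrable cube_uniform (\<lambda>\<omega>. h k * indicator (C k) \<omega>)" for k
    using C_sets by (intro integrable_mult_right integrable_real_indicator) (auto simp: less_top[symmetric])
  have "(\<integral>\<omega>. h (?K \<omega>) \<partial>cube_uniform) = (\<integral>\<omega>. (\<Sum>k\<in>?A. h k * indicator (C k) \<omega>) \<partial>cube_uniform)"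
    using decomp meas C_sets by (intro integral_cong_AE) auto
  also have "\<dots> = (\<Sum>k\<in>?A. h k * measure cube_uniform (C k))"
    using int by (subst Bochner_Integration.integral_sum) auto
  also have "\<dots> = (\<Sum>k\<in>?A. h k * (1 / real (card ?A)))"
    by (intro sum.cong refl) (simp add: C_prob)
  finally show ?thesis
    by (simp add: sum_divide_distrib)
qed

text \<open>The average over the grid is an expectation over the discretized vector \<open>\<lceil>n U\<rceil> / n\<close>, which
  converges to \<open>U\<close> almost surely; so the limit follows by dominated convergence.\<close>

lemma grid_average_tendsto_cube_integral:
  fixes g :: "real ^ 's \<Rightarrow> real"
  assumes cont: "continuous_on UNIV g" and bdd: "\<And>x. \<bar>g x\<bar> \<le> B"
  shows "(\<lambda>n. (\<Sum>k\<in>UNIV \<rightarrow>\<^sub>E {1..n}. g (\<chi> i. real (k i) / real n))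
               / real (card ((UNIV :: 's set) \<rightarrow>\<^sub>E {1..n})))
           \<longlonglongrightarrow> (\<integral>\<omega>. g (\<chi> i. \<omega> i) \<partial>cube_uniform)"
proof -
  interpret P: prob_space "cube_uniform :: ('s \<Rightarrow> real) measure"
    by (rule prob_space_cube_uniform)
  have [measurable]: "g \<in> borel_measurable borel"
    using cont by (rule borel_measurable_continuous_onI)
  have "(\<lambda>n. \<integral>\<omega>. g (\<chi> i. real (nat \<lceil>real n * \<omega> i\<rceil>) / real n) \<partial>cube_uniform)
          \<longlonglongrightarrow> (\<integral>\<omega>. g (\<chi> i. \<omega> i) \<partial>cube_uniform)"
  proof (rule integral_dominated_convergence[where w = "\<lambda>_. B"])
    show "(\<lambda>\<omega>. g (\<chi> i. \<omega> i)) \<in> borel_measurable (cube_uniform :: ('s \<Rightarrow> real) measure)"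
      by (rule measurable_compose[OF borel_measurable_vec_lambda]) measurable
    show "(\<lambda>\<omega>. g (\<chi> i. real (nat \<lceil>real n * \<omega> i\<rceil>) / real n))
            \<in> borel_measurable (cube_uniform :: ('s \<Rightarrow> real) measure)" for n
      by (rule measurable_compose[OF borel_measurable_vec_lambda]) measurable
    show "AE \<omega> in cube_uniform. (\<lambda>n. g (\<chi> i. real (nat \<lceil>real n * \<omega> i\<rceil>) / real n)) \<longlonglongrightarrow> g (\<chi> i. \<omega> i)"
      using AE_cube_uniform
    proof eventually_elim
      case (elim \<omega>)
      have "isCont g (\<chi> i. \<omega> i)"
        using cont by (simp add: continuous_on_eq_continuous_at)
      then show ?case
        using elim less_imp_le
        by (intro isCont_tendsto_compose[of _ g] tendsto_vec_lambda tendsto_ceiling_over_n) auto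
    qed
  qed (use bdd in auto)
  moreover have "\<forall>\<^sub>F n in sequentially.
      (\<integral>\<omega>. g (\<chi> i. real (nat \<lceil>real n * \<omega> i\<rceil>) / real n) \<partial>cube_uniform)
        = (\<Sum>k\<in>UNIV \<rightarrow>\<^sub>E {1..n}. g (\<chi> i. real (k i) / real n)) / real (card ((UNIV :: 's set) \<rightarrow>\<^sub>E {1..n}))"
    using eventually_gt_at_top[of 0]
    by eventually_elim (rule integral_discretized_cube_uniform)
  ultimately show ?thesis
    by (rule Lim_transform_eventually)
qed

section \<open>The law of the limit\<close>

text \<open>For \<open>r \<noteq> 1 / 2\<close> the map has slope \<open>1 - 2 r\<close>, so it scales Lebesgue measure by \<open>\<bar>1 - 2 r\<bar>\<close>, the length of the
  image of the unit interval.\<close>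

lemma distr_affine_unit_uniform:
  "distr unit_uniform borel (\<lambda>u. r + (1 - 2 * r) * u) = uniform_between r (1 - r)"
proof (cases "r = 1 / 2")
  case True
  show ?thesis
    unfolding True using prob_space.distr_const[OF prob_space_unit_uniform, of "1 / 2" borel]
    by (simp add: uniform_between_def)
next
  case False
  define c where "c = 1 - 2 * r"
  have c: "c \<noteq> 0"
    using False by (simp add: c_def)
  define I where "I = {min r (1 - r)..max r (1 - r)}"
  have I: "emeasure lborel I = ennreal \<bar>c\<bar>"
    unfolding I_def by (subst emeasure_lborel_Icc) (auto simp: c_def min_def max_def)
  have image: "r + c * u \<in> I \<longleftrightarrow> u \<in> {0..1}" for u
  proof (cases "0 < c")
    case True
    then have "I = {r..r + c}"
      by (auto simp: I_def c_def)
    with True show ?thesis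
      by (simp add: mult_le_cancel_left1 zero_le_mult_iff)
  next
    case False
    with c have "c < 0"
      by simp
    moreover from this have "I = {r + c..r}"
      by (auto simp: I_def c_def)
    ultimately show ?thesis
      by (simp add: mult_le_cancel_left1 mult_le_0_iff mult_le_cancel_left2)
         (auto simp: mult_le_cancel_left1)
  qed
  have "distr unit_uniform borel (\<lambda>u. r + c * u) = uniform_measure lborel I"
  proof (rule measure_eqI)
    fix A :: "real set"
    assume "A \<in> sets (distr unit_uniform borel (\<lambda>u. r + c * u))"
    then have A [measurable]: "A \<in> sets borel"
      by simp
    have meas: "(\<lambda>u. r + c * u) \<in> measurable unit_uniform borel"
      by measurable
    have [measurable]: "I \<in> sets borel"
      by (simp add: I_def)
    have "emeasure lborel (I \<inter> A)
            = emeasure (density (distr lborel borel (\<lambda>u. r + c * u)) (\<lambda>_. ennreal \<bar>c\<bar>)) (I \<inter> A)"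
      by (subst lborel_real_affine[OF c, of r]) (rule refl)
    also have "\<dots> = ennreal \<bar>c\<bar> * emeasure lborel ((\<lambda>u. r + c * u) -` (I \<inter> A))"
      by (subst emeasure_density_const) (auto simp: emeasure_distr)
    also have "(\<lambda>u. r + c * u) -` (I \<inter> A) = {0..1} \<inter> (\<lambda>u. r + c * u) -` A"
      using image by auto
    finally have "emeasure lborel (I \<inter> A) / emeasure lborel I
        = ennreal \<bar>c\<bar> * emeasure lborel ({0..1} \<inter> (\<lambda>u. r + c * u) -` A) / ennreal \<bar>c\<bar>"
      by (simp add: I)
    also have "\<dots> = emeasure lborel ({0..1} \<inter> (\<lambda>u. r + c * u) -` A)"
      using c by (subst mult.commute) (simp add: mult_divide_eq_ennreal)
    also have "\<dots> = emeasure unit_uniform ((\<lambda>u. r + c * u) -` A)"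
    proof (rule emeasure_unit_uniform[symmetric])
      show "(\<lambda>u. r + c * u) -` A \<in> sets borel"
        using measurable_sets_borel[of "\<lambda>u. r + c * u" borel A] by simp
    qed
    finally show "emeasure (distr unit_uniform borel (\<lambda>u. r + c * u)) A
                    = emeasure (uniform_measure lborel I) A"
      using emeasure_distr[OF meas A] by simp
  qed simp
  then show ?thesis
    using False by (simp add: uniform_between_def I_def c_def)
qed

text \<open>Joint laws of independent variables are determined by their marginals, so the limit can be
  realized on the cube, as the image of independent uniform variables under affine maps.\<close>

lemma integral_indep_uniform_between:
  fixes r :: "'s::finite \<Rightarrow> real" and M :: "'w measure" and D :: "'s \<Rightarrow> 'w \<Rightarrow> real"
    and f :: "real ^ 's \<Rightarrow> real"
  assumes M: "prob_space M"
    and indep: "prob_space.indep_vars M (\<lambda>_. borel) D UNIV"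
    and law: "\<And>i. distr M borel (D i) = uniform_between (r i) (1 - r i)"
    and f [measurable]: "f \<in> borel_measurable borel"
  shows "(\<integral>x. f (\<chi> i. D i x) \<partial>M) = (\<integral>\<omega>. f (\<chi> i. r i + (1 - 2 * r i) * \<omega> i) \<partial>cube_uniform)"
proof -
  interpret M: prob_space M
    by (rule M)
  have D [measurable]: "D i \<in> borel_measurable M" for i
    using indep by (auto simp: M.indep_vars_def)
  let ?Q = "\<Pi>\<^sub>M i\<in>(UNIV :: 's set). (borel :: real measure)"
  let ?\<nu> = "\<lambda>i. distr unit_uniform borel (\<lambda>u. r i + (1 - 2 * r i) * u)"
  let ?T = "\<lambda>(\<omega> :: 's \<Rightarrow> real) i. r i + (1 - 2 * r i) * \<omega> i"
  interpret N: product_prob_space ?\<nu> UNIV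
    by (intro product_prob_spaceI prob_space.prob_space_distr prob_space_unit_uniform) measurable
  have DQ: "(\<lambda>x i. D i x) \<in> measurable M ?Q"
    by (rule measurable_PiM_single'[OF D]) (simp add: space_PiM)
  have "(\<lambda>\<omega>. ?T \<omega> i) \<in> borel_measurable cube_uniform" for i
    by measurable
  then have TQ: "?T \<in> measurable cube_uniform ?Q"
    by (rule measurable_PiM_single') (simp add: space_PiM)
  have "(\<lambda>d. d i) \<in> borel_measurable ?Q" for i
    by (rule measurable_component_singleton) simp
  then have "(\<lambda>d. \<chi> i. d i) \<in> borel_measurable ?Q"
    by (rule borel_measurable_vec_lambda)
  from measurable_compose[OF this f] have fQ: "(\<lambda>d. f (\<chi> i. d i)) \<in> borel_measurable ?Q" .
  have "distr M ?Q (\<lambda>x i. D i x) = (\<Pi>\<^sub>M i\<in>UNIV. distr M borel (D i))"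
    using M.indep_vars_iff_distr_eq_PiM[of UNIV D "\<lambda>_. borel"] indep
    by (simp add: restrict_def)
  also have "\<dots> = (\<Pi>\<^sub>M i\<in>UNIV. ?\<nu> i)"
    by (simp only: law distr_affine_unit_uniform)
  also have "\<dots> = distr cube_uniform ?Q ?T"
  proof (rule N.PiM_eqI[symmetric])
    show "sets (distr cube_uniform ?Q ?T) = sets (\<Pi>\<^sub>M i\<in>UNIV. ?\<nu> i)"
      by (simp only: sets_distr, intro sets_PiM_cong) auto
    fix A :: "'s \<Rightarrow> real set"
    assume "\<And>i. i \<in> UNIV \<Longrightarrow> A i \<in> sets (?\<nu> i)"
    then have A: "A i \<in> sets borel" for i
      by simp
    have "emeasure (distr cube_uniform ?Q ?T) (Pi\<^sub>E UNIV A) = emeasure cube_uniform (?T -` Pi\<^sub>E UNIV A)"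
      using A by (subst emeasure_distr[OF TQ]) (auto intro!: sets_PiM_I_finite)
    also have "?T -` Pi\<^sub>E UNIV A = (\<Pi>\<^sub>E i\<in>UNIV. (\<lambda>u. r i + (1 - 2 * r i) * u) -` A i)"
      by (auto simp: PiE_UNIV_domain)
    also have "emeasure cube_uniform \<dots>
        = (\<Prod>i\<in>UNIV. emeasure unit_uniform ((\<lambda>u. r i + (1 - 2 * r i) * u) -` A i))"
    proof (rule emeasure_cube_uniform_box)
      show "(\<lambda>u. r i + (1 - 2 * r i) * u) -` A i \<in> sets borel" for i
        using measurable_sets_borel[of "\<lambda>u. r i + (1 - 2 * r i) * u" borel "A i"] A by simp
    qed
    also have "\<dots> = (\<Prod>i\<in>UNIV. emeasure (?\<nu> i) (A i))"
      using A by (intro prod.cong refl) (simp add: emeasure_distr)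
    finally show "emeasure (distr cube_uniform ?Q ?T) (Pi\<^sub>E UNIV A) = (\<Prod>i\<in>UNIV. emeasure (?\<nu> i) (A i))" .
  qed simp
  finally have eq: "distr M ?Q (\<lambda>x i. D i x) = distr cube_uniform ?Q ?T" .
  show ?thesis
    using integral_distr[OF DQ fQ] integral_distr[OF TQ fQ] by (simp add: eq)
qed

section \<open>Convergence of the degrees\<close>

text \<open>Up to rounding, the scaled degree is \<open>r + u - 2 A / n\<close> with \<open>u = p i / n\<close> and \<open>A\<close> concentrated
  around \<open>n r u\<close>. The rounding errors amount to at most \<open>7 / n\<close>, and the deviation of \<open>A\<close>
  enters with a factor \<open>2 / n\<close>; the constant is \<open>2 * 7\<^sup>2 + 2 * 2\<^sup>2\<close>.\<close>

lemma degree_near_affine_second_moment: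
  assumes n: "2 \<le> n" and r: "0 < r" "r \<le> 1"
  defines "i \<equiv> nat \<lceil>real n * r\<rceil>"
  shows "measure_pmf.expectation (uniform_perm n)
           (\<lambda>p. (real (perm_degree n p i) / real n - (r + (1 - 2 * r) * (real (p i) / real n)))\<^sup>2)
         \<le> 106 / real n"
proof -
  let ?E = "measure_pmf.expectation (uniform_perm n)"
  define S where "S p = real (card {j \<in> {1..<i}. p j < p i})
                  - (real i - 1) * (real (p i) - 1) / (real n - 1)" for p :: "nat \<Rightarrow> nat"
  have i: "i \<in> {1..n}"
    unfolding i_def using n r by (intro ceiling_in_grid) auto
  have "real i = of_int \<lceil>real n * r\<rceil>"
    using n r by (simp add: i_def)
  then have ir: "real n * r \<le> real i" "real i < real n * r + 1"
    by linarith+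
  have pointwise: "(real (perm_degree n p i) / real n - (r + (1 - 2 * r) * (real (p i) / real n)))\<^sup>2
                     \<le> (98 + 8 * (S p)\<^sup>2) / (real n)\<^sup>2" if p: "p permutes {1..n}" for p
  proof -
    define q where "q = real (p i)"
    define \<rho> where "\<rho> = (real i - 1) / (real n - 1)"
    have "p i \<in> {1..n}"
      using permutes_in_image[OF p] i by blast
    then have q: "1 \<le> q" "q \<le> real n"
      by (auto simp: q_def)
    have "\<bar>(\<rho> - r) * (q - 1)\<bar> \<le> 1"
    proof -
      have "(\<rho> - r) * (real n - 1) = real i - 1 - r * (real n - 1)"
        using n unfolding \<rho>_def left_diff_distrib[of _ r] by simp
      then have "\<bar>(\<rho> - r) * (real n - 1)\<bar> \<le> 1"
        using ir r by (simp add: algebra_simps abs_le_iff)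
      moreover have "\<bar>(\<rho> - r) * (q - 1)\<bar> \<le> \<bar>(\<rho> - r) * (real n - 1)\<bar>"
        unfolding abs_mult using q by (intro mult_left_mono) auto
      ultimately show ?thesis
        by linarith
    qed
    define w where "w = \<rho> * (q - 1) - r * q"
    have w: "\<bar>w\<bar> \<le> 2"
      using \<open>\<bar>(\<rho> - r) * (q - 1)\<bar> \<le> 1\<close> r by (simp add: w_def algebra_simps abs_le_iff)
    define e where "e = real (perm_degree n p i) - (real n * r + (1 - 2 * r) * q)"
    have "e = (real i - real n * r) - 2 - 2 * S p - 2 * w"
      unfolding e_def w_def perm_degree_formula[OF p i] S_def \<rho>_def q_def by (simp add: algebra_simps)
    then have "\<bar>e\<bar> \<le> 7 + 2 * \<bar>S p\<bar>"
      using w ir by linarith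
    then have "e\<^sup>2 \<le> (7 + 2 * \<bar>S p\<bar>)\<^sup>2"
      by (metis abs_ge_zero power2_abs power_mono)
    also have "\<dots> \<le> 98 + 8 * (S p)\<^sup>2"
    proof -
      have "0 \<le> (7 - 2 * \<bar>S p\<bar>)\<^sup>2"
        by simp
      then show ?thesis
        by (simp add: power2_eq_square algebra_simps)
    qed
    finally have "e\<^sup>2 / (real n)\<^sup>2 \<le> (98 + 8 * (S p)\<^sup>2) / (real n)\<^sup>2"
      by (rule divide_right_mono) simp
    moreover have "real (perm_degree n p i) / real n - (r + (1 - 2 * r) * (real (p i) / real n)) = e / real n"
      using n by (simp add: e_def q_def field_simps)
    ultimately show ?thesis
      by (simp add: power_divide)
  qed
  have "?E (\<lambda>p. (real (perm_degree n p i) / real n - (r + (1 - 2 * r) * (real (p i) / real n)))\<^sup>2)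
          \<le> ?E (\<lambda>p. (98 + 8 * (S p)\<^sup>2) / (real n)\<^sup>2)"
    by (rule integral_mono_AE)
      (use pointwise in \<open>simp_all add: AE_measure_pmf_iff set_pmf_uniform_perm\<close>)
  also have "\<dots> = (98 + 8 * ?E (\<lambda>p. (S p)\<^sup>2)) / (real n)\<^sup>2"
    by simp
  also have "\<dots> \<le> (98 * real n + 8 * real n) / (real n)\<^sup>2"
    using smaller_left_second_moment[OF n i] n
    by (intro divide_right_mono add_mono mult_left_mono) (auto simp: S_def)
  also have "\<dots> = 106 / real n"
    using n by (simp add: power2_eq_square)
  finally show ?thesis .
qed

text \<open>A bounded function that is continuous on a compact set is uniformly continuous there, so it has
  the property \<open>\<bar>f x - f y\<bar> \<le> \<epsilon> + C * (dist x y)\<^sup>2\<close> there for a suitable \<open>C\<close>; taking expectations, closeness in mean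
  square is enough.\<close>

lemma expectation_diff_tendsto_0:
  fixes f :: "'a::metric_space \<Rightarrow> real" and N :: "nat \<Rightarrow> 'b pmf"
  assumes K: "compact K" and cont: "continuous_on K f" and bdd: "\<And>x. \<bar>f x\<bar> \<le> B"
    and fin: "\<And>n. finite (set_pmf (N n))"
    and XY: "\<forall>\<^sub>F n in sequentially. \<forall>p\<in>set_pmf (N n). X n p \<in> K \<and> Y n p \<in> K"
    and L2: "(\<lambda>n. measure_pmf.expectation (N n) (\<lambda>p. (dist (X n p) (Y n p))\<^sup>2)) \<longlonglongrightarrow> 0"
  shows "(\<lambda>n. measure_pmf.expectation (N n) (\<lambda>p. f (X n p))
              - measure_pmf.expectation (N n) (\<lambda>p. f (Y n p))) \<longlonglongrightarrow> 0"
proof (rule tendstoI)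
  fix e :: real
  assume e: "0 < e"
  have int [simp]: "integrable (measure_pmf (N n)) g" for n and g :: "'b \<Rightarrow> real"
    by (rule integrable_measure_pmf_finite[OF fin])
  have "uniformly_continuous_on K f"
    using cont K by (rule compact_uniformly_continuous)
  then obtain d where d: "0 < d" and close: "\<And>x y. x \<in> K \<Longrightarrow> y \<in> K \<Longrightarrow> dist x y < d \<Longrightarrow> \<bar>f x - f y\<bar> < e / 2"
    using e unfolding uniformly_continuous_on_def dist_real_def
    by (metis dist_commute half_gt_zero)
  define C where "C = 2 * B / d\<^sup>2"
  have "0 \<le> B"
    using bdd[of undefined] by linarith
  have pointwise: "\<bar>f x - f y\<bar> \<le> e / 2 + C * (dist x y)\<^sup>2" if "x \<in> K" "y \<in> K" for x y
  proof (cases "dist x y < d")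
    case True
    then have "\<bar>f x - f y\<bar> < e / 2"
      using close that by blast
    moreover have "0 \<le> C * (dist x y)\<^sup>2"
      using \<open>0 \<le> B\<close> by (simp add: C_def)
    ultimately show ?thesis
      by linarith
  next
    case False
    have "\<bar>f x - f y\<bar> \<le> 2 * B"
      using bdd[of x] bdd[of y] by linarith
    also have "\<dots> = C * d\<^sup>2"
      using d by (simp add: C_def)
    also have "\<dots> \<le> C * (dist x y)\<^sup>2"
      using False d \<open>0 \<le> B\<close> by (intro mult_left_mono power_mono) (auto simp: C_def)
    finally show ?thesis
      using e by linarith
  qed
  have "(\<lambda>n. C * measure_pmf.expectation (N n) (\<lambda>p. (dist (X n p) (Y n p))\<^sup>2)) \<longlonglongrightarrow> C * 0"
    by (intro tendsto_intros L2)
  then have "\<forall>\<^sub>F n in sequentially. C * measure_pmf.expectation (N n) (\<lambda>p. (dist (X n p) (Y n p))\<^sup>2) < e / 2"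
    using e by (intro order_tendstoD) auto
  with XY show "\<forall>\<^sub>F n in sequentially. dist (measure_pmf.expectation (N n) (\<lambda>p. f (X n p))
              - measure_pmf.expectation (N n) (\<lambda>p. f (Y n p))) 0 < e"
  proof eventually_elim
    case (elim n)
    let ?E = "measure_pmf.expectation (N n)"
    have "\<bar>?E (\<lambda>p. f (X n p)) - ?E (\<lambda>p. f (Y n p))\<bar> = \<bar>?E (\<lambda>p. f (X n p) - f (Y n p))\<bar>"
      by simp
    also have "\<dots> \<le> ?E (\<lambda>p. \<bar>f (X n p) - f (Y n p)\<bar>)"
      by (rule integral_abs_bound)
    also have "\<dots> \<le> ?E (\<lambda>p. e / 2 + C * (dist (X n p) (Y n p))\<^sup>2)"
      using elim(1) pointwise by (intro integral_mono_AE) (auto simp: AE_measure_pmf_iff)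
    also have "\<dots> = e / 2 + C * ?E (\<lambda>p. (dist (X n p) (Y n p))\<^sup>2)"
      by simp
    also have "\<dots> < e"
      using elim(2) by simp
    finally show ?case
      by (simp add: dist_real_def)
  qed
qed

lemma perm_degree_le:
  assumes "i \<in> {1..n}"
  shows "perm_degree n p i \<le> n"
  unfolding perm_degree_eq_card_inversions[OF assms]
  by (rule order.trans[OF card_mono[of "{1..n}"]]) auto

text \<open>After division by \<open>n\<close> the positions converge to the distinct numbers \<open>r i\<close>.\<close>

lemma eventually_inj_ceiling_positions:
  fixes r :: "'s::finite \<Rightarrow> real"
  assumes "inj r" and "\<And>i. 0 \<le> r i"
  shows "\<forall>\<^sub>F n in sequentially. inj (\<lambda>i. nat \<lceil>real n * r i\<rceil>)"
proof -
  have "\<forall>\<^sub>F n in sequentially. i \<noteq> j \<longrightarrow> nat \<lceil>real n * r i\<rceil> \<noteq> nat \<lceil>real n * r j\<rceil>" for i j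
  proof (cases "i = j")
    case False
    have "(\<lambda>n. real (nat \<lceil>real n * r i\<rceil>) / real n - real (nat \<lceil>real n * r j\<rceil>) / real n)
            \<longlonglongrightarrow> r i - r j"
      by (intro tendsto_diff tendsto_ceiling_over_n assms(2))
    moreover have "r i - r j \<noteq> 0"
      using False assms(1) by (auto simp: inj_def)
    ultimately show ?thesis
      by (rule eventually_mono[OF tendsto_imp_eventually_ne]) auto
  qed simp
  then have "\<forall>\<^sub>F n in sequentially. \<forall>i j. i \<noteq> j \<longrightarrow> nat \<lceil>real n * r i\<rceil> \<noteq> nat \<lceil>real n * r j\<rceil>"
    by (intro eventually_all_finite)
  then show ?thesis
    by eventually_elim (auto simp: inj_def)
qed

theorem corollary3p3:
  fixes r :: "'s::{finite, linorder} \<Rightarrow> real"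
    and M :: "'w measure" and D :: "'s \<Rightarrow> 'w \<Rightarrow> real"
  assumes "strict_mono r" and "\<And>i. 0 < r i" and "\<And>i. r i \<le> 1"
    and "prob_space M"
    and "prob_space.indep_vars M (\<lambda>_. borel) D UNIV"
    and "\<And>i. distr M borel (D i) = uniform_between (r i) (1 - r i)"
  shows "converges_in_distribution
           (\<lambda>n. measure_pmf (uniform_perm n))
           (\<lambda>n p. \<chi> i. real (perm_degree n p (nat \<lceil>real n * r i\<rceil>)) / real n)
           M (\<lambda>x. \<chi> i. D i x)"
proof -
  define a where "a n i = nat \<lceil>real n * r i\<rceil>" for n i
  define X where "X n p = (\<chi> i. real (perm_degree n p (a n i)) / real n)" for n p
  define T where "T v = (\<chi> i. r i + (1 - 2 * r i) * v $ i)" for v :: "(real, 's) vec"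
  define V where "V n k = (\<chi> i. real (k i) / real n)" for n and k :: "'s \<Rightarrow> nat"
  let ?E = "\<lambda>n. measure_pmf.expectation (uniform_perm n)"
  interpret M: prob_space M
    by (rule assms(4))
  have D: "D i \<in> borel_measurable M" for i
    using assms(5) by (auto simp: M.indep_vars_def)
  have grid: "a n i \<in> {1..n}" if "0 < n" for n i
    unfolding a_def using assms(2,3) that by (intro ceiling_in_grid) auto
  have lim: "(\<lambda>n. ?E n (\<lambda>p. f (X n p))) \<longlonglongrightarrow> (\<integral>x. f (\<chi> i. D i x) \<partial>M)"
    if f: "continuous_on UNIV f" "bounded (range f)" for f :: "(real, 's) vec \<Rightarrow> real"
  proof -
    obtain B where B: "\<And>x. \<bar>f x\<bar> \<le> B"
      using f(2) by (auto simp: bounded_iff)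
    have fT: "continuous_on UNIV (\<lambda>v. f (T v))"
      unfolding T_def by (intro continuous_on_compose2[OF f(1)] continuous_intros) auto
    \<comment> \<open>Both vectors lie in the unit cube, since degrees are at most \<open>n\<close> and \<open>r + (1 - 2 r) u\<close> is a
      convex combination of \<open>r\<close> and \<open>1 - r\<close>.\<close>
    have "(\<lambda>n. ?E n (\<lambda>p. f (X n p)) - ?E n (\<lambda>p. f (T (V n (p \<circ> a n))))) \<longlonglongrightarrow> 0"
    proof (rule expectation_diff_tendsto_0[where f = f and X = X
          and Y = "\<lambda>n p. T (V n (p \<circ> a n))"])
      show "compact (cbox 0 (\<chi> i. 1) :: (real, 's) vec set)"
        by (rule compact_cbox)
      show "continuous_on (cbox 0 (\<chi> i. 1)) f"
        using f(1) by (rule continuous_on_subset) simp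
      show "\<bar>f x\<bar> \<le> B" for x
        by (rule B)
      show "finite (set_pmf (uniform_perm n))" for n
        by (rule finite_set_pmf_uniform_perm)
      show "\<forall>\<^sub>F n in sequentially. \<forall>p\<in>set_pmf (uniform_perm n).
              X n p \<in> cbox 0 (\<chi> i. 1) \<and> T (V n (p \<circ> a n)) \<in> cbox 0 (\<chi> i. 1)"
        using eventually_gt_at_top[of 0]
      proof eventually_elim
        case (elim n)
        show ?case
        proof (intro ballI conjI)
          fix p
          assume "p \<in> set_pmf (uniform_perm n)"
          then have p: "p permutes {1..n}"
            by (simp add: set_pmf_uniform_perm)
          show "X n p \<in> cbox 0 (\<chi> i. 1)"
            using perm_degree_le[OF grid[OF elim]] elim by (auto simp: mem_box_cart X_def)
          have "r i + (1 - 2 * r i) * (real (p (a n i)) / real n) \<in> {0..1}" for i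
          proof -
            define u where "u = real (p (a n i)) / real n"
            have "p (a n i) \<in> {1..n}"
              using permutes_in_image[OF p] grid[OF elim] by blast
            then have u: "0 \<le> u" "u \<le> 1"
              by (auto simp: u_def)
            have r: "0 \<le> r i" "r i \<le> 1"
              using assms(2,3)[of i] by auto
            have "r i + (1 - 2 * r i) * u = (1 - u) * r i + u * (1 - r i)"
              by (simp add: algebra_simps)
            moreover have "(1 - u) * r i + u * (1 - r i) \<le> 1"
              using u r by (intro convex_bound_le) auto
            ultimately show ?thesis
              using u r by (simp add: u_def)
          qed
          then show "T (V n (p \<circ> a n)) \<in> cbox 0 (\<chi> i. 1)"
            by (auto simp: mem_box_cart T_def V_def)
        qed
      qed
      show "(\<lambda>n. ?E n (\<lambda>p. (dist (X n p) (T (V n (p \<circ> a n))))\<^sup>2)) \<longlonglongrightarrow> 0"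
      proof (rule Lim_null_comparison)
        show "\<forall>\<^sub>F n in sequentially. norm (?E n (\<lambda>p. (dist (X n p) (T (V n (p \<circ> a n))))\<^sup>2))
                \<le> real CARD('s) * (106 / real n)"
          using eventually_ge_at_top[of 2]
        proof eventually_elim
          case (elim n)
          have "?E n (\<lambda>p. (dist (X n p) (T (V n (p \<circ> a n))))\<^sup>2)
              = (\<Sum>i\<in>UNIV. ?E n (\<lambda>p. (real (perm_degree n p (a n i)) / real n
                    - (r i + (1 - 2 * r i) * (real (p (a n i)) / real n)))\<^sup>2))"
            by (simp add: dist_vec_def L2_set_def sum_nonneg X_def T_def V_def dist_real_def)
          also have "\<dots> \<le> (\<Sum>i\<in>(UNIV :: 's set). 106 / real n)"
            unfolding a_def using elim assms(2,3)
            by (intro sum_mono degree_near_affine_second_moment) auto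
          finally show ?case
            by simp
        qed
        have "(\<lambda>n. real CARD('s) * (106 / real n)) \<longlonglongrightarrow> real CARD('s) * 0"
          by (intro tendsto_intros lim_const_over_n)
        then show "(\<lambda>n. real CARD('s) * (106 / real n)) \<longlonglongrightarrow> 0"
          by simp
      qed
    qed
    moreover have "(\<lambda>n. ?E n (\<lambda>p. f (T (V n (p \<circ> a n)))))
        \<longlonglongrightarrow> (\<integral>\<omega>. f (T (\<chi> i. \<omega> i)) \<partial>cube_uniform)"
    proof (rule expectation_at_positions_tendsto[where h = "\<lambda>n k. f (T (V n k))"])
      have "inj r"
        using assms(1) by (rule strict_mono_imp_inj_on)
      moreover have "0 \<le> r i" for i
        using assms(2)[of i] by simp
      ultimately have "\<forall>\<^sub>F n in sequentially. inj (\<lambda>i. nat \<lceil>real n * r i\<rceil>)"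
        by (rule eventually_inj_ceiling_positions)
      from this eventually_gt_at_top[of 0]
      show "\<forall>\<^sub>F n in sequentially. inj (a n) \<and> range (a n) \<subseteq> {1..n}"
        by eventually_elim (use grid in \<open>auto simp: a_def[abs_def]\<close>)
      show "\<bar>f (T (V n k))\<bar> \<le> B" for n k
        by (rule B)
      show "(\<lambda>n. (\<Sum>k\<in>UNIV \<rightarrow>\<^sub>E {1..n}. f (T (V n k))) / real (card ((UNIV :: 's set) \<rightarrow>\<^sub>E {1..n})))
              \<longlonglongrightarrow> (\<integral>\<omega>. f (T (\<chi> i. \<omega> i)) \<partial>cube_uniform)"
        unfolding V_def by (rule grid_average_tendsto_cube_integral[OF fT B])
    qed
    moreover have "(\<integral>\<omega>. f (T (\<chi> i. \<omega> i)) \<partial>cube_uniform) = (\<integral>x. f (\<chi> i. D i x) \<partial>M)"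
      using integral_indep_uniform_between[OF assms(4-6) borel_measurable_continuous_onI[OF f(1)]]
      by (simp add: T_def)
    ultimately show ?thesis
      using tendsto_add by fastforce
  qed
  show ?thesis
    unfolding converges_in_distribution_def
    using lim borel_measurable_vec_lambda[of D M, OF D]
    by (auto simp: X_def a_def measure_pmf.prob_space_axioms M.prob_space_axioms)
qed

end
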